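(* Let $X$ be either $H^\infty(\mathbb{D})$ or $\mathcal{B}$, and let $g\in H^\infty(\mathbb{D})$. Then $C_\varphi I_g-I_gC_\varphi:X\to\mathcal{B}$ is compact for every $\varphi\in S(\mathbb{D})$ if and only if $g$ is constant.
   Context: $\mathbb{D}$ is the open unit disk in $\mathbb{C}$, $H(\mathbb{D})$ is the set of holomorphic functions on $\mathbb{D}$, $H^\infty(\mathbb{D})$ the bounded ones with the supremum norm, and $S(\mathbb{D})$ is the set of holomorphic maps $\mathbb{D}\to\mathbb{D}$. For $\varphi\in S(\mathbb{D})$, $C_\varphi f=f\circ\varphi$. For $g,f\in H(\mathbb{D})$, $I_gf(z)=\int_0^z f'(\zeta)g(\zeta)\,d\zeta$. The Bloch space $\mathcal{B}$ is the set of $f\in H(\mathbb{D})$ with $\|f\|_*=\sup_{z\in\mathbb{D}}(1-|z|^2)|f'(z)|<\infty$, a Banach space with norm $|f(0)|+\|f\|_*$. (The operator $I_g:X\to\mathcal{B}$ is bounded exactly when $g\in H^\infty(\mathbb{D})$.) *)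

theory Defs
  imports "HOL-Complex_Analysis.Complex_Analysis"
begin

abbreviation unit_disc :: "complex set" ("\<D>")
  where "\<D> \<equiv> ball 0 1"

text \<open>
  Functions on the disc are represented by total functions that vanish outside the disc, so that
  functions agreeing on the disc are equal and the norms below are norms, not just seminorms.
\<close>

definition holo_disc :: "(complex \<Rightarrow> complex) set"
  where "holo_disc = {f. f holomorphic_on \<D> \<and> (\<forall>z. z \<notin> \<D> \<longrightarrow> f z = 0)}"

definition self_maps :: "(complex \<Rightarrow> complex) set"
  where "self_maps = {\<phi>. \<phi> holomorphic_on \<D> \<and> \<phi> \<in> \<D> \<rightarrow> \<D>}"

definition H_infty :: "(complex \<Rightarrow> complex) set"
  where "H_infty = {f \<in> holo_disc. bounded (f ` \<D>)}"

definition H_infty_norm :: "(complex \<Rightarrow> complex) \<Rightarrow> real"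
  where "H_infty_norm f = (SUP z\<in>\<D>. norm (f z))"

definition bloch :: "(complex \<Rightarrow> complex) set"
  where "bloch = {f \<in> holo_disc. bdd_above ((\<lambda>z. (1 - (norm z)\<^sup>2) * norm (deriv f z)) ` \<D>)}"

definition bloch_seminorm :: "(complex \<Rightarrow> complex) \<Rightarrow> real"
  where "bloch_seminorm f = (SUP z\<in>\<D>. (1 - (norm z)\<^sup>2) * norm (deriv f z))"

definition bloch_norm :: "(complex \<Rightarrow> complex) \<Rightarrow> real"
  where "bloch_norm f = norm (f 0) + bloch_seminorm f"

definition comp_op :: "(complex \<Rightarrow> complex) \<Rightarrow> (complex \<Rightarrow> complex) \<Rightarrow> complex \<Rightarrow> complex"
  where "comp_op \<phi> f = (\<lambda>z. if z \<in> \<D> then f (\<phi> z) else 0)"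

definition int_op :: "(complex \<Rightarrow> complex) \<Rightarrow> (complex \<Rightarrow> complex) \<Rightarrow> complex \<Rightarrow> complex"
  where "int_op g f =
    (\<lambda>z. if z \<in> \<D> then contour_integral (linepath 0 z) (\<lambda>\<zeta>. deriv f \<zeta> * g \<zeta>) else 0)"

definition commutator :: "(complex \<Rightarrow> complex) \<Rightarrow> (complex \<Rightarrow> complex) \<Rightarrow>
    (complex \<Rightarrow> complex) \<Rightarrow> complex \<Rightarrow> complex"
  where "commutator \<phi> g f = (\<lambda>z. comp_op \<phi> (int_op g f) z - int_op g (comp_op \<phi> f) z)"

text \<open>
  The case distinction is irrelevant for the topology below: the locale \<open>Metric_space\<close> wants
  symmetry and nonnegativity also off the carrier, where \<open>N\<close> is junk.
\<close>

definition norm_dist :: "(complex \<Rightarrow> complex) set \<Rightarrow> ((complex \<Rightarrow> complex) \<Rightarrow> real) \<Rightarrow>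
    (complex \<Rightarrow> complex) \<Rightarrow> (complex \<Rightarrow> complex) \<Rightarrow> real"
  where "norm_dist X N f h = (if f \<in> X \<and> h \<in> X then N (\<lambda>z. f z - h z) else 0)"

definition linear_map_on :: "(complex \<Rightarrow> complex) set \<Rightarrow> (complex \<Rightarrow> complex) set \<Rightarrow>
    ((complex \<Rightarrow> complex) \<Rightarrow> complex \<Rightarrow> complex) \<Rightarrow> bool"
  where "linear_map_on X Y T \<longleftrightarrow> T \<in> X \<rightarrow> Y \<and>
    (\<forall>f\<in>X. \<forall>h\<in>X. \<forall>a b. T (\<lambda>z. a * f z + b * h z) = (\<lambda>z. a * T f z + b * T h z))"

text \<open>
  \<open>T\<close> is a compact operator between the function spaces \<open>X\<close> and \<open>Y\<close> with norms \<open>NX\<close> and \<open>NY\<close>: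
  it is linear and the image of the closed unit ball is relatively compact in \<open>Y\<close>.
\<close>

definition compact_operator :: "(complex \<Rightarrow> complex) set \<Rightarrow> ((complex \<Rightarrow> complex) \<Rightarrow> real) \<Rightarrow>
    (complex \<Rightarrow> complex) set \<Rightarrow> ((complex \<Rightarrow> complex) \<Rightarrow> real) \<Rightarrow>
    ((complex \<Rightarrow> complex) \<Rightarrow> complex \<Rightarrow> complex) \<Rightarrow> bool"
  where "compact_operator X NX Y NY T \<longleftrightarrow> linear_map_on X Y T \<and>
    compactin (Metric_space.mtopology Y (norm_dist Y NY))
      (Metric_space.mtopology Y (norm_dist Y NY) closure_of (T ` {f \<in> X. NX f \<le> 1}))"

text \<open>
  The topology used in \<open>compact_operator\<close> is meaningful for the Bloch space:
\<close>

lemma bloch_diff: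
  assumes "f \<in> bloch" "h \<in> bloch"
  shows "(\<lambda>z. f z - h z) \<in> bloch"
    and "bloch_norm (\<lambda>z. f z - h z) \<le> bloch_norm f + bloch_norm h"
proof -
  let ?w = "\<lambda>f z. (1 - (norm z)\<^sup>2) * norm (deriv f z)"
  have hol: "f holomorphic_on \<D>" "h holomorphic_on \<D>" and
    bdd: "bdd_above (?w f ` \<D>)" "bdd_above (?w h ` \<D>)"
    using assms by (auto simp: bloch_def holo_disc_def)
  have bd: "?w (\<lambda>z. f z - h z) z \<le> bloch_seminorm f + bloch_seminorm h" if z: "z \<in> \<D>" for z
  proof -
    have d: "deriv (\<lambda>z. f z - h z) z = deriv f z - deriv h z"
      using hol z by (intro deriv_diff) (auto simp: holomorphic_on_imp_differentiable_at)
    have "0 \<le> 1 - (norm z)\<^sup>2"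
      using z by (simp add: power_le_one)
    then have "?w (\<lambda>z. f z - h z) z \<le> (1 - (norm z)\<^sup>2) * (norm (deriv f z) + norm (deriv h z))"
      unfolding d by (intro mult_left_mono norm_triangle_ineq4)
    also have "\<dots> = ?w f z + ?w h z"
      by (simp add: distrib_left)
    also have "\<dots> \<le> bloch_seminorm f + bloch_seminorm h"
      unfolding bloch_seminorm_def using z bdd by (intro add_mono cSUP_upper)
    finally show ?thesis .
  qed
  then have "bdd_above (?w (\<lambda>z. f z - h z) ` \<D>)"
    by (intro bdd_aboveI2)
  then show "(\<lambda>z. f z - h z) \<in> bloch"
    using assms by (auto simp: bloch_def holo_disc_def intro: holomorphic_on_diff)
  have "bloch_seminorm (\<lambda>z. f z - h z) \<le> bloch_seminorm f + bloch_seminorm h"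
    by (subst bloch_seminorm_def, rule cSUP_least) (use bd in auto)
  moreover have "norm (f 0 - h 0) \<le> norm (f 0) + norm (h 0)"
    by (rule norm_triangle_ineq4)
  ultimately show "bloch_norm (\<lambda>z. f z - h z) \<le> bloch_norm f + bloch_norm h"
    unfolding bloch_norm_def by linarith
qed

lemma bloch_weight_le:
  assumes "f \<in> bloch" "z \<in> \<D>"
  shows "(1 - (norm z)\<^sup>2) * norm (deriv f z) \<le> bloch_seminorm f"
  using assms unfolding bloch_seminorm_def bloch_def by (intro cSUP_upper) auto

lemma bloch_seminorm_nonneg:
  assumes "f \<in> bloch" shows "0 \<le> bloch_seminorm f"
  using bloch_weight_le[OF assms, of 0] order_trans[OF norm_ge_zero, of "deriv f 0"] by simp

lemma bloch_norm_eq_0: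
  assumes "f \<in> bloch" "bloch_norm f = 0"
  shows "f = (\<lambda>_. 0)"
proof -
  have hol: "f holomorphic_on \<D>" and off: "\<And>z. z \<notin> \<D> \<Longrightarrow> f z = 0"
    using assms by (auto simp: bloch_def holo_disc_def)
  have s0: "bloch_seminorm f = 0" and f0: "f 0 = 0"
    using assms(2) bloch_seminorm_nonneg[OF assms(1)]
    by (simp_all add: bloch_norm_def add_nonneg_eq_0_iff)
  have d0: "deriv f z = 0" if z: "z \<in> \<D>" for z
  proof -
    have "0 < 1 - (norm z)\<^sup>2"
      using z by (simp add: power_less_one_iff)
    moreover have "(1 - (norm z)\<^sup>2) * norm (deriv f z) \<le> 0"
      using bloch_weight_le[OF assms(1) z] s0 by simp
    ultimately show ?thesis
      by (simp add: mult_le_0_iff)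
  qed
  have "f z = 0" if z: "z \<in> \<D>" for z
  proof -
    have "(f has_field_derivative 0) (at x)" if "x \<in> \<D>" for x
      using holomorphic_derivI[OF hol open_ball that] d0[OF that] by simp
    then obtain c where "\<And>x. x \<in> \<D> \<Longrightarrow> f x = c"
      using has_field_derivative_zero_constant[of "\<D>" f]
      by (meson convex_ball has_field_derivative_at_within)
    then show ?thesis
      using z f0 by (metis centre_in_ball zero_less_one)
  qed
  then show ?thesis
    using off by blast
qed

lemma bloch_norm_minus_commute:
  assumes "f \<in> bloch" "h \<in> bloch"
  shows "bloch_norm (\<lambda>z. f z - h z) = bloch_norm (\<lambda>z. h z - f z)"
proof -
  have "deriv (\<lambda>z. h z - f z) z = - deriv (\<lambda>z. f z - h z) z" if "z \<in> \<D>" for z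
  proof -
    have "f field_differentiable at z" "h field_differentiable at z"
      using assms that
      by (auto simp: bloch_def holo_disc_def intro: holomorphic_on_imp_differentiable_at)
    then show ?thesis
      by simp
  qed
  then have "bloch_seminorm (\<lambda>z. f z - h z) = bloch_seminorm (\<lambda>z. h z - f z)"
    unfolding bloch_seminorm_def by (intro SUP_cong) auto
  then show ?thesis
    by (simp add: bloch_norm_def norm_minus_commute)
qed

lemma Metric_space_bloch: "Metric_space bloch (norm_dist bloch bloch_norm)"
proof
  show "0 \<le> norm_dist bloch bloch_norm f h" for f h
    using bloch_diff(1)[of f h] bloch_seminorm_nonneg[of "\<lambda>z. f z - h z"]
    by (auto simp: norm_dist_def bloch_norm_def)
  show "norm_dist bloch bloch_norm f h = norm_dist bloch bloch_norm h f" for f h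
    using bloch_norm_minus_commute by (auto simp: norm_dist_def)
  show "norm_dist bloch bloch_norm f h = 0 \<longleftrightarrow> f = h" if "f \<in> bloch" "h \<in> bloch" for f h
  proof
    assume "norm_dist bloch bloch_norm f h = 0"
    then have "(\<lambda>z. f z - h z) = (\<lambda>_. 0)"
      using that by (intro bloch_norm_eq_0 bloch_diff) (auto simp: norm_dist_def)
    then show "f = h"
      by (simp add: fun_eq_iff)
  next
    assume "f = h"
    then show "norm_dist bloch bloch_norm f h = 0"
      by (simp add: norm_dist_def bloch_norm_def bloch_seminorm_def)
  qed
  show "norm_dist bloch bloch_norm f k \<le> norm_dist bloch bloch_norm f h + norm_dist bloch bloch_norm h k"
    if "f \<in> bloch" "h \<in> bloch" "k \<in> bloch" for f h k
    using bloch_diff(2)[OF bloch_diff(1)[OF that(1,2)] bloch_diff(1)[OF that(3,2)]]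
      bloch_norm_minus_commute[OF that(3,2)] that
    by (simp add: norm_dist_def)
qed

end

theory Submission imports Defs "HOL-Real_Asymp.Real_Asymp" begin

text \<open>
  The proof rests on the identity
  \<open>deriv (commutator \<phi> g f) = (f' \<circ> \<phi>) \<cdot> \<phi>' \<cdot> (g \<circ> \<phi> - g)\<close> on the disc.

  If \<open>g\<close> is a constant \<open>c\<close>, the right-hand side vanishes, and the commutator sends \<open>f\<close> to the
  constant \<open>c (f (\<phi> 0) - f 0)\<close> (lemma \<open>commutator_const\<close>).  Evaluation at \<open>\<phi> 0\<close> and at \<open>0\<close> is
  bounded on the unit ball of \<open>X\<close>, so this ball is mapped into a compact disc of constants.

  Conversely, rotations \<open>\<phi> z = \<lambda> z\<close> already force \<open>g\<close> to be constant.  Put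
  \<open>h z = g (\<lambda> z) - g z\<close> and test the commutator on \<open>f\<^sub>n z = z\<^bsup>n+1\<^esup> / 2\<close>, which lies in the unit
  balls of both spaces.  The images have derivatives of modulus \<open>(n + 1) \<bar>z\<bar>\<^bsup>n\<^esup> \<bar>h z\<bar> / 2\<close>.  These
  tend to \<open>0\<close> at each point, so any limit in the Bloch norm of a subsequence of images has
  derivative zero.  On the other hand the
  Bloch weight times \<open>(n + 1) \<bar>z\<bar>\<^bsup>n\<^esup>\<close> stays bounded below on the circle of radius
  \<open>1 - 1 / (2 (n + 1))\<close>, and by the maximum principle \<open>\<bar>h\<bar>\<close> has on that circle a value at least as
  large as its value at any prescribed point inside it.  Hence compactness forces \<open>h = 0\<close>
  (lemma \<open>rotation_invariant_if_compact\<close>).  A function invariant under all rotations is constant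
  on each circle about \<open>0\<close>, hence constant, again by the maximum principle.
\<close>

section \<open>The commutator and its derivative\<close>

lemma holo_disc_linear:
  assumes "f \<in> holo_disc" "h \<in> holo_disc"
  shows "(\<lambda>z. a * f z + b * h z) \<in> holo_disc"
proof -
  have "(\<lambda>z. a * f z + b * h z) holomorphic_on \<D>"
    using assms by (intro holomorphic_intros) (auto simp: holo_disc_def)
  then show ?thesis
    using assms by (auto simp: holo_disc_def)
qed

lemma comp_op_holo_disc:
  assumes "\<phi> \<in> self_maps" "f \<in> holo_disc"
  shows "comp_op \<phi> f \<in> holo_disc"
proof -
  have "(f \<circ> \<phi>) holomorphic_on \<D>"
    using assms
    by (intro holomorphic_on_compose_gen[where t = "\<D>"]) (auto simp: self_maps_def holo_disc_def)
  then have "comp_op \<phi> f holomorphic_on \<D>"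
    by (rule holomorphic_transform) (simp add: comp_op_def)
  then show ?thesis
    by (simp add: holo_disc_def comp_op_def)
qed

lemma comp_op_deriv:
  assumes "\<phi> \<in> self_maps" "f holomorphic_on \<D>" "z \<in> \<D>"
  shows "(comp_op \<phi> f has_field_derivative deriv f (\<phi> z) * deriv \<phi> z) (at z)"
proof -
  have "\<phi> holomorphic_on \<D>" and \<phi>z: "\<phi> z \<in> \<D>"
    using assms(1,3) by (auto simp: self_maps_def)
  then have "(f \<circ> \<phi> has_field_derivative deriv f (\<phi> z) * deriv \<phi> z) (at z)"
    using assms(2,3) \<phi>z by (intro DERIV_chain holomorphic_derivI[OF _ open_ball])
  then show ?thesis
    by (rule has_field_derivative_transform_within_open[OF _ open_ball assms(3)])
      (simp add: comp_op_def)
qed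

lemma int_op_eq_primitive:
  assumes "\<And>x. x \<in> \<D> \<Longrightarrow> (F has_field_derivative deriv f x * g x) (at x within \<D>)" "z \<in> \<D>"
  shows "int_op g f z = F z - F 0"
proof -
  have "path_image (linepath 0 z) \<subseteq> \<D>"
    using assms(2) by (simp add: closed_segment_subset)
  then have "((\<lambda>x. deriv f x * g x) has_contour_integral F z - F 0) (linepath 0 z)"
    using contour_integral_primitive[OF assms(1) valid_path_linepath] by simp
  then show ?thesis
    using assms(2) by (simp add: int_op_def contour_integral_unique)
qed

lemma int_op_deriv:
  assumes "f holomorphic_on \<D>" "g holomorphic_on \<D>" "z \<in> \<D>"
  shows "(int_op g f has_field_derivative deriv f z * g z) (at z)"
proof -
  have "(\<lambda>x. deriv f x * g x) holomorphic_on \<D>"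
    using assms by (intro holomorphic_intros) auto
  then obtain F where
    F: "\<And>x. x \<in> \<D> \<Longrightarrow> (F has_field_derivative deriv f x * g x) (at x within \<D>)"
    by (rule holomorphic_convex_primitive'[OF convex_ball open_ball]) blast
  have "((\<lambda>x. F x - F 0) has_field_derivative deriv f z * g z - 0) (at z)"
    using F[OF assms(3)] assms(3)
    by (intro DERIV_diff DERIV_const) (simp add: at_within_open[OF _ open_ball])
  then have "((\<lambda>x. F x - F 0) has_field_derivative deriv f z * g z) (at z)"
    by simp
  then show ?thesis
    by (rule has_field_derivative_transform_within_open[OF _ open_ball assms(3)])
      (rule int_op_eq_primitive[where F = F, OF F, symmetric])
qed

text \<open>
  The two terms have derivatives \<open>f' (\<phi> z) g (\<phi> z) \<phi>' z\<close> and \<open>f' (\<phi> z) \<phi>' z g z\<close>: they differ only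
  in the point at which \<open>g\<close> is evaluated.
\<close>

lemma commutator_deriv:
  assumes "\<phi> \<in> self_maps" "f \<in> holo_disc" "g holomorphic_on \<D>" "z \<in> \<D>"
  shows "deriv (commutator \<phi> g f) z = deriv f (\<phi> z) * deriv \<phi> z * (g (\<phi> z) - g z)"
proof -
  have f: "f holomorphic_on \<D>" and cf: "comp_op \<phi> f holomorphic_on \<D>"
    using assms(2) comp_op_holo_disc[OF assms(1,2)] by (auto simp: holo_disc_def)
  have \<phi>z: "\<phi> z \<in> \<D>"
    using assms(1,4) by (auto simp: self_maps_def)
  have int: "int_op g f holomorphic_on \<D>"
    unfolding holomorphic_on_open[OF open_ball] using int_op_deriv[OF f assms(3)] by blast
  have "((\<lambda>z. comp_op \<phi> (int_op g f) z - int_op g (comp_op \<phi> f) z) has_field_derivative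
      deriv (int_op g f) (\<phi> z) * deriv \<phi> z - deriv (comp_op \<phi> f) z * g z) (at z)"
    by (intro DERIV_diff comp_op_deriv int_op_deriv assms int cf)
  moreover have "deriv (int_op g f) (\<phi> z) = deriv f (\<phi> z) * g (\<phi> z)"
    by (rule DERIV_imp_deriv[OF int_op_deriv[OF f assms(3) \<phi>z]])
  moreover have "deriv (comp_op \<phi> f) z = deriv f (\<phi> z) * deriv \<phi> z"
    by (rule DERIV_imp_deriv[OF comp_op_deriv[OF assms(1) f assms(4)]])
  ultimately show ?thesis
    unfolding commutator_def by (simp add: DERIV_imp_deriv algebra_simps)
qed

section \<open>Constant symbols\<close>

definition disc_const :: "complex \<Rightarrow> complex \<Rightarrow> complex"
  where "disc_const k = (\<lambda>z. if z \<in> \<D> then k else 0)"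

lemma deriv_disc_const:
  assumes "z \<in> \<D>"
  shows "deriv (disc_const k) z = 0"
proof -
  have "((\<lambda>_. k) has_field_derivative 0) (at z)"
    by simp
  then have "(disc_const k has_field_derivative 0) (at z)"
    by (rule has_field_derivative_transform_within_open[OF _ open_ball assms])
      (simp add: disc_const_def)
  then show ?thesis
    by (rule DERIV_imp_deriv)
qed

lemma disc_const_bloch: "disc_const k \<in> bloch"
proof -
  have "disc_const k holomorphic_on \<D>"
    by (rule holomorphic_transform[OF holomorphic_on_const[of k]]) (simp add: disc_const_def)
  moreover have "bdd_above ((\<lambda>z. (1 - (norm z)\<^sup>2) * norm (deriv (disc_const k) z)) ` \<D>)"
    by (intro bdd_aboveI2[where M = 0]) (simp add: deriv_disc_const)
  ultimately show ?thesis
    by (simp add: bloch_def holo_disc_def disc_const_def)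
qed

lemma bloch_norm_disc_const: "bloch_norm (disc_const k) = norm k"
proof -
  have "bloch_seminorm (disc_const k) = (SUP z\<in>\<D>. 0)"
    unfolding bloch_seminorm_def by (intro SUP_cong) (auto simp: deriv_disc_const)
  then show ?thesis
    by (simp add: bloch_norm_def disc_const_def)
qed

lemma norm_dist_disc_const: "norm_dist bloch bloch_norm (disc_const a) (disc_const b) = dist a b"
proof -
  have "(\<lambda>z. disc_const a z - disc_const b z) = disc_const (a - b)"
    by (auto simp: disc_const_def)
  then show ?thesis
    by (simp add: norm_dist_def disc_const_bloch bloch_norm_disc_const dist_norm)
qed

lemma compactin_disc_const_cball:
  "compactin (Metric_space.mtopology bloch (norm_dist bloch bloch_norm)) (disc_const ` cball 0 M)"
proof (rule image_compactin)
  show "compactin euclidean (cball (0::complex) M)"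
    by simp
  show "continuous_map euclidean (Metric_space.mtopology bloch (norm_dist bloch bloch_norm)) disc_const"
    unfolding Metric_space.continuous_map_to_metric[OF Metric_space_bloch]
  proof (intro ballI allI impI)
    fix x :: complex and e :: real
    assume "e > 0"
    then show "\<exists>U. openin euclidean U \<and> x \<in> U \<and>
        (\<forall>y\<in>U. disc_const y \<in> Metric_space.mball bloch (norm_dist bloch bloch_norm) (disc_const x) e)"
      by (intro exI[of _ "ball x e"])
        (auto simp: Metric_space.in_mball[OF Metric_space_bloch] disc_const_bloch
          norm_dist_disc_const)
  qed
qed

text \<open>
  For constant \<open>g = c\<close> the operator \<open>int_op g\<close> is \<open>f \<mapsto> c (f - f 0)\<close>, so only the
  two base-point values survive in the commutator.
\<close>

lemma commutator_const:
  assumes "\<phi> \<in> self_maps" "f \<in> holo_disc" "\<And>z. z \<in> \<D> \<Longrightarrow> g z = c"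
  shows "commutator \<phi> g f = disc_const (c * (f (\<phi> 0) - f 0))"
proof -
  have int: "int_op g u z = c * u z - c * u 0" if "u \<in> holo_disc" "z \<in> \<D>" for u z
  proof (rule int_op_eq_primitive[where F = "\<lambda>z. c * u z"])
    fix x assume x: "x \<in> \<D>"
    have "(u has_field_derivative deriv u x) (at x within \<D>)"
      using that(1) x has_field_derivative_at_within[OF holomorphic_derivI[OF _ open_ball]]
      by (auto simp: holo_disc_def)
    from DERIV_cmult[OF this, of c]
    show "((\<lambda>z. c * u z) has_field_derivative deriv u x * g x) (at x within \<D>)"
      using assms(3)[OF x] by (simp add: mult.commute)
  qed (rule that)
  have \<phi>: "\<phi> z \<in> \<D>" if "z \<in> \<D>" for z
    using assms(1) that by (auto simp: self_maps_def)
  have "commutator \<phi> g f z = c * (f (\<phi> 0) - f 0)" if z: "z \<in> \<D>" for z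
  proof -
    have "comp_op \<phi> (int_op g f) z = c * f (\<phi> z) - c * f 0"
      using z by (simp add: comp_op_def int[OF assms(2) \<phi>[OF z]])
    moreover have "int_op g (comp_op \<phi> f) z = c * f (\<phi> z) - c * f (\<phi> 0)"
      unfolding int[OF comp_op_holo_disc[OF assms(1,2)] z] using z by (simp add: comp_op_def)
    ultimately show ?thesis
      unfolding commutator_def by (simp add: right_diff_distrib)
  qed
  moreover have "commutator \<phi> g f z = 0" if "z \<notin> \<D>" for z
    using that unfolding commutator_def comp_op_def int_op_def by (simp only: if_False diff_self)
  ultimately show ?thesis
    unfolding disc_const_def by auto
qed

text \<open>
  On the segment from \<open>0\<close> to \<open>w\<close> the weight is at least \<open>1 - \<bar>w\<bar>\<^sup>2\<close>, so the derivative is bounded there.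
\<close>

lemma bloch_increment_bound:
  assumes "f \<in> bloch" "w \<in> \<D>"
  shows "norm (f w - f 0) \<le> bloch_seminorm f / (1 - (norm w)\<^sup>2)"
proof -
  let ?S = "cball (0::complex) (norm w)"
  let ?B = "bloch_seminorm f / (1 - (norm w)\<^sup>2)"
  have w: "norm w < 1" and pos: "0 < 1 - (norm w)\<^sup>2"
    using assms(2) by (auto simp: power_less_one_iff)
  have B0: "0 \<le> ?B"
    using pos bloch_seminorm_nonneg[OF assms(1)] by simp
  have "norm (f w - f 0) \<le> ?B * norm (w - 0)"
  proof (rule field_differentiable_bound[of ?S f "deriv f"])
    fix x assume x: "x \<in> ?S"
    then have xD: "x \<in> \<D>"
      using w by auto
    then show "(f has_field_derivative deriv f x) (at x within ?S)"
      using assms(1) has_field_derivative_at_within[OF holomorphic_derivI[OF _ open_ball]]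
      by (auto simp: bloch_def holo_disc_def)
    have "(norm x)\<^sup>2 \<le> (norm w)\<^sup>2"
      using x by (intro power_mono) auto
    then have "(1 - (norm w)\<^sup>2) * norm (deriv f x) \<le> (1 - (norm x)\<^sup>2) * norm (deriv f x)"
      by (intro mult_right_mono) auto
    also have "\<dots> \<le> bloch_seminorm f"
      by (rule bloch_weight_le[OF assms(1) xD])
    finally show "norm (deriv f x) \<le> ?B"
      using pos by (simp add: pos_le_divide_eq mult.commute)
  qed auto
  also have "\<dots> \<le> ?B * 1"
    using w B0 by (intro mult_left_mono) auto
  finally show ?thesis
    by simp
qed

lemma unit_ball_increment_bound:
  assumes "(X, NX) = (H_infty, H_infty_norm) \<or> (X, NX) = (bloch, bloch_norm)" "w \<in> \<D>"
  obtains M where "\<And>f. f \<in> X \<Longrightarrow> NX f \<le> 1 \<Longrightarrow> norm (f w - f 0) \<le> M"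
  using assms(1)
proof
  assume X: "(X, NX) = (H_infty, H_infty_norm)"
  have "norm (f w - f 0) \<le> 2" if f: "f \<in> X" "NX f \<le> 1" for f
  proof -
    have "bdd_above ((\<lambda>z. norm (f z)) ` \<D>)"
      using f X by (auto simp: H_infty_def bounded_iff intro: bdd_aboveI2)
    then have "norm (f z) \<le> 1" if "z \<in> \<D>" for z
      using cSUP_upper[OF that, of "\<lambda>z. norm (f z)"] f(2) X by (simp add: H_infty_norm_def)
    from this[OF assms(2)] this[of 0] show ?thesis
      using norm_triangle_ineq4[of "f w" "f 0"] by simp
  qed
  then show thesis
    by (rule that)
next
  assume X: "(X, NX) = (bloch, bloch_norm)"
  have pos: "0 < 1 - (norm w)\<^sup>2"
    using assms(2) by (auto simp: power_less_one_iff)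
  have "norm (f w - f 0) \<le> 1 / (1 - (norm w)\<^sup>2)" if f: "f \<in> X" "NX f \<le> 1" for f
  proof -
    have "bloch_seminorm f \<le> 1"
    proof -
      have "norm (f 0) + bloch_seminorm f \<le> 1"
        using f(2) X by (simp add: bloch_norm_def)
      then show ?thesis
        using norm_ge_zero[of "f 0"] by linarith
    qed
    then have "bloch_seminorm f / (1 - (norm w)\<^sup>2) \<le> 1 / (1 - (norm w)\<^sup>2)"
      using pos by (intro divide_right_mono) auto
    then show ?thesis
      using bloch_increment_bound[OF _ assms(2), of f] f(1) X by simp
  qed
  then show thesis
    by (rule that)
qed

lemma commutator_compact_if_const:
  assumes X: "(X, NX) = (H_infty, H_infty_norm) \<or> (X, NX) = (bloch, bloch_norm)"
    and \<phi>: "\<phi> \<in> self_maps" and g: "\<And>z. z \<in> \<D> \<Longrightarrow> g z = c"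
  shows "compact_operator X NX bloch bloch_norm (commutator \<phi> g)"
proof -
  let ?T = "commutator \<phi> g"
  let ?top = "Metric_space.mtopology bloch (norm_dist bloch bloch_norm)"
  have sub: "X \<subseteq> holo_disc"
    using X by (auto simp: H_infty_def bloch_def)
  have T: "?T f = disc_const (c * (f (\<phi> 0) - f 0))" if "f \<in> holo_disc" for f
    by (rule commutator_const[OF \<phi> that g])
  have lin: "linear_map_on X bloch ?T"
    unfolding linear_map_on_def
  proof (intro conjI ballI allI)
    show "?T \<in> X \<rightarrow> bloch"
      using T sub disc_const_bloch by auto
    fix f h a b
    assume "f \<in> X" "h \<in> X"
    then have fh: "f \<in> holo_disc" "h \<in> holo_disc"
      using sub by auto
    show "?T (\<lambda>z. a * f z + b * h z) = (\<lambda>z. a * ?T f z + b * ?T h z)"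
      unfolding T[OF holo_disc_linear[OF fh]] T[OF fh(1)] T[OF fh(2)]
      by (auto simp: disc_const_def algebra_simps)
  qed
  have "\<phi> 0 \<in> \<D>"
    using \<phi> by (auto simp: self_maps_def)
  with X obtain M where M: "\<And>f. f \<in> X \<Longrightarrow> NX f \<le> 1 \<Longrightarrow> norm (f (\<phi> 0) - f 0) \<le> M"
    by (rule unit_ball_increment_bound) blast
  let ?K = "disc_const ` cball 0 (norm c * M)"
  have K: "compactin ?top ?K"
    by (rule compactin_disc_const_cball)
  have "closedin ?top ?K"
    by (rule compactin_imp_closedin[OF Metric_space.Hausdorff_space_mtopology K])
      (rule Metric_space_bloch)
  moreover have "?T ` {f \<in> X. NX f \<le> 1} \<subseteq> ?K"
  proof (rule image_subsetI)
    fix f assume "f \<in> {f \<in> X. NX f \<le> 1}"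
    then have "?T f = disc_const (c * (f (\<phi> 0) - f 0))" "norm (f (\<phi> 0) - f 0) \<le> M"
      using T sub M by auto
    then show "?T f \<in> ?K"
      by (auto simp: norm_mult intro!: imageI mult_left_mono)
  qed
  ultimately have "?top closure_of (?T ` {f \<in> X. NX f \<le> 1}) \<subseteq> ?K"
    by (intro closure_of_minimal)
  then have "compactin ?top (?top closure_of (?T ` {f \<in> X. NX f \<le> 1}))"
    by (rule closed_compactin[OF K _ closedin_closure_of])
  with lin show ?thesis
    by (simp add: compact_operator_def)
qed

section \<open>Normalised powers as test functions\<close>

definition test_power :: "nat \<Rightarrow> complex \<Rightarrow> complex"
  where "test_power n = (\<lambda>z. if z \<in> \<D> then z ^ Suc n / 2 else 0)"

lemma test_power_deriv:
  assumes "z \<in> \<D>"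
  shows "(test_power n has_field_derivative of_nat (Suc n) * z ^ n / 2) (at z)"
proof -
  have "((\<lambda>z. z ^ Suc n / 2) has_field_derivative of_nat (Suc n) * z ^ n / 2) (at z)"
    by (rule derivative_eq_intros refl | simp)+
  then show ?thesis
    by (rule has_field_derivative_transform_within_open[OF _ open_ball assms])
      (simp add: test_power_def)
qed

lemma test_power_holo_disc: "test_power n \<in> holo_disc"
proof -
  have "test_power n holomorphic_on \<D>"
    unfolding holomorphic_on_open[OF open_ball] using test_power_deriv by blast
  then show ?thesis
    by (simp add: holo_disc_def test_power_def)
qed

text \<open>
  By the geometric sum, \<open>(1 - r) (n + 1) r\<^bsup>n\<^esup> \<le> (1 - r) (1 + r + \<dots> + r\<^bsup>n\<^esup>) = 1 - r\<^bsup>n+1\<^esup>\<close>; the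
  other factor \<open>1 + r \<le> 2\<close> of the weight is absorbed by the normalisation \<open>1 / 2\<close>.
\<close>

lemma test_power_weight_le:
  assumes "z \<in> \<D>"
  shows "(1 - (norm z)\<^sup>2) * norm (deriv (test_power n) z) \<le> 1"
proof -
  define r where "r = norm z"
  have r: "0 \<le> r" "r < 1"
    using assms by (auto simp: r_def)
  have "real (Suc n) * r ^ n = (\<Sum>i\<le>n. r ^ n)"
    by simp
  also have "\<dots> \<le> (\<Sum>i\<le>n. r ^ i)"
    using r by (intro sum_mono power_decreasing) auto
  finally have "(1 - r) * (real (Suc n) * r ^ n) \<le> (1 - r) * (\<Sum>i\<le>n. r ^ i)"
    using r by (intro mult_left_mono) auto
  also have "\<dots> = 1 - r ^ Suc n"
    by (simp only: one_diff_power_eq[of r "Suc n"] lessThan_Suc_atMost)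
  also have "\<dots> \<le> 1"
    using r by simp
  finally have "(1 + r) * ((1 - r) * (real (Suc n) * r ^ n)) \<le> 2 * 1"
    using r by (intro mult_mono) auto
  moreover have "norm (deriv (test_power n) z) = real (Suc n) * r ^ n / 2"
    by (simp add: DERIV_imp_deriv[OF test_power_deriv[OF assms]] r_def norm_mult norm_divide
        norm_power del: of_nat_Suc)
  moreover have "1 - r\<^sup>2 = (1 + r) * (1 - r)"
    by (simp add: power2_eq_square algebra_simps)
  ultimately show ?thesis
    by (simp only: r_def[symmetric] mult.assoc times_divide_eq_right)
qed

lemma test_power_in_unit_ball:
  assumes "(X, NX) = (H_infty, H_infty_norm) \<or> (X, NX) = (bloch, bloch_norm)"
  shows "test_power n \<in> {f \<in> X. NX f \<le> 1}"
proof -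
  have le: "norm (test_power n z) \<le> 1" if "z \<in> \<D>" for z
  proof -
    have "norm z ^ Suc n \<le> 1"
      using that by (intro power_le_one) auto
    then show ?thesis
      using that by (simp add: test_power_def norm_divide norm_mult norm_power)
  qed
  have "test_power n \<in> H_infty"
    using le test_power_holo_disc unfolding H_infty_def bounded_iff by blast
  moreover have "H_infty_norm (test_power n) \<le> 1"
    unfolding H_infty_norm_def using le by (intro cSUP_least) auto
  moreover have "test_power n \<in> bloch"
    using test_power_holo_disc test_power_weight_le[of _ n]
    by (auto simp: bloch_def intro!: bdd_aboveI2)
  moreover have "bloch_norm (test_power n) \<le> 1"
  proof -
    have "bloch_seminorm (test_power n) \<le> 1"
      unfolding bloch_seminorm_def using test_power_weight_le by (intro cSUP_least) auto
    then show ?thesis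
      by (simp add: bloch_norm_def test_power_def)
  qed
  ultimately show ?thesis
    using assms by auto
qed

text \<open>
  The weight times \<open>(n + 1) r\<^bsup>n\<^esup>\<close> is largest at a distance of order \<open>1 / n\<close> from the boundary;
  the factor \<open>2\<close> in the radius lets Bernoulli's inequality bound \<open>r\<^bsup>n\<^esup>\<close> below by \<open>1 / 2\<close>.
\<close>

lemma weighted_power_lower_bound:
  assumes "r = 1 - 1 / (2 * real (Suc n))"
  shows "1 / 4 \<le> (1 - r\<^sup>2) * (real (Suc n) * r ^ n)"
proof -
  have r: "0 \<le> r" "r < 1"
    unfolding assms by simp_all
  have "1 / 2 \<le> 1 + real n * (- 1 / (2 * real (Suc n)))"
    by (simp add: field_simps)
  also have "\<dots> \<le> (1 + - 1 / (2 * real (Suc n))) ^ n"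
    by (rule Bernoulli_inequality) (simp add: field_simps)
  also have "\<dots> = r ^ n"
    by (simp add: assms)
  finally have pow: "1 / 2 \<le> r ^ n" .
  have "1 / 2 = (1 - r) * real (Suc n)"
    using assms by (simp add: field_simps del: of_nat_Suc)
  also have "\<dots> \<le> (1 - r\<^sup>2) * real (Suc n)"
    using r by (intro mult_right_mono) (auto simp: power2_eq_square intro: mult_left_le)
  finally have "1 / 2 \<le> (1 - r\<^sup>2) * real (Suc n)" .
  from mult_mono[OF this pow] r show ?thesis
    by (simp add: mult.assoc power_le_one)
qed

section \<open>Rotations force the symbol to be constant\<close>

lemma maximum_modulus_on_circle:
  assumes "h holomorphic_on \<D>" "norm w \<le> r" "r < 1"
  obtains z where "norm z = r" "norm (h w) \<le> norm (h z)"
proof -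
  have sub: "cball 0 r \<subseteq> \<D>"
    using assms(3) by auto
  have r0: "0 \<le> r"
    using assms(2) norm_ge_zero order_trans by blast
  have cont: "continuous_on (cball 0 r) h"
    by (rule holomorphic_on_imp_continuous_on[OF holomorphic_on_subset[OF assms(1) sub]])
  have "continuous_on (sphere 0 r) (\<lambda>z. norm (h z))"
    by (intro continuous_on_norm continuous_on_subset[OF cont] sphere_cball)
  moreover have "sphere (0::complex) r \<noteq> {}"
    using r0 by auto
  ultimately obtain z where z: "z \<in> sphere 0 r" "\<And>y. y \<in> sphere 0 r \<Longrightarrow> norm (h y) \<le> norm (h z)"
    using continuous_attains_sup[OF compact_sphere] by metis
  have "norm (h w) \<le> norm (h z)"
  proof (rule maximum_modulus_frontier[where S = "cball 0 r" and f = h])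
    show "h holomorphic_on interior (cball 0 r)"
      using sub interior_subset by (intro holomorphic_on_subset[OF assms(1)]) blast
    show "continuous_on (closure (cball 0 r)) h"
      using cont by simp
    show "norm (h y) \<le> norm (h z)" if "y \<in> frontier (cball 0 r)" for y
      using z(2) that by simp
  qed (use assms(2) in auto)
  with z(1) show ?thesis
    by (intro that) auto
qed

lemma rotation_self_map:
  assumes "norm u = 1"
  shows "(*) u \<in> self_maps"
proof -
  have "(*) u holomorphic_on \<D>"
    by (intro holomorphic_intros)
  then show ?thesis
    using assms by (auto simp: self_maps_def norm_mult)
qed

lemma rotated_difference_holomorphic:
  assumes "g holomorphic_on \<D>" "norm u = 1"
  shows "(\<lambda>z. g (u * z) - g z) holomorphic_on \<D>"
proof -
  have "(g \<circ> (*) u) holomorphic_on \<D>"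
    using rotation_self_map[OF assms(2)] assms(1)
    by (intro holomorphic_on_compose_gen[where t = "\<D>"]) (auto simp: self_maps_def)
  then show ?thesis
    using assms(1) by (auto simp: comp_def intro: holomorphic_on_diff)
qed

lemma norm_deriv_commutator_rotation:
  assumes "g holomorphic_on \<D>" "norm u = 1" "z \<in> \<D>"
  shows "norm (deriv (commutator ((*) u) g (test_power n)) z)
    = real (Suc n) * norm z ^ n / 2 * norm (g (u * z) - g z)"
proof -
  have "u * z \<in> \<D>"
    using assms by (simp add: norm_mult)
  moreover have "deriv ((*) u) z = u"
    by (rule DERIV_imp_deriv) (rule derivative_eq_intros refl | simp)+
  ultimately show ?thesis
    using assms
    by (simp add: commutator_deriv[OF rotation_self_map test_power_holo_disc]
        DERIV_imp_deriv[OF test_power_deriv] norm_mult norm_divide norm_power del: of_nat_Suc)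
qed

text \<open>
  Every cluster point of the images of \<open>test_power\<close> is constant, because the images have derivatives
  tending to \<open>0\<close> pointwise.  Along a subsequence the images then get close to a constant in the Bloch
  norm, while for all large \<open>n\<close> their seminorms are at least \<open>\<bar>h w\<bar> / 8\<close>, where
  \<open>h z = g (u z) - g z\<close>.  So \<open>h w = 0\<close>.
\<close>

lemma rotation_invariant_if_compact:
  assumes X: "(X, NX) = (H_infty, H_infty_norm) \<or> (X, NX) = (bloch, bloch_norm)"
    and g: "g holomorphic_on \<D>" and u: "norm u = 1"
    and comp: "compact_operator X NX bloch bloch_norm (commutator ((*) u) g)"
    and w: "w \<in> \<D>"
  shows "g (u * w) = g w"
proof (rule ccontr)
  interpret Metric_space bloch "norm_dist bloch bloch_norm"
    by (rule Metric_space_bloch)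
  assume neq: "g (u * w) \<noteq> g w"
  define h where "h = (\<lambda>z. g (u * z) - g z)"
  define \<sigma> where "\<sigma> = (\<lambda>n. commutator ((*) u) g (test_power n))"
  let ?S = "commutator ((*) u) g ` {f \<in> X. NX f \<le> 1}"
  have hol: "h holomorphic_on \<D>"
    unfolding h_def by (rule rotated_difference_holomorphic[OF g u])
  have nd: "norm (deriv (\<sigma> n) z) = real (Suc n) * norm z ^ n / 2 * norm (h z)" if "z \<in> \<D>" for n z
    unfolding \<sigma>_def h_def by (rule norm_deriv_commutator_rotation[OF g u that])
  have "?S \<subseteq> bloch"
    using comp by (auto simp: compact_operator_def linear_map_on_def)
  moreover have "\<sigma> n \<in> ?S" for n
    unfolding \<sigma>_def by (intro imageI test_power_in_unit_ball X)
  ultimately have \<sigma>: "\<sigma> n \<in> bloch" "\<sigma> n \<in> mtopology closure_of ?S" for n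
    using closure_of_subset[of ?S mtopology] by auto
  then have range: "range \<sigma> \<subseteq> mtopology closure_of ?S"
    by blast
  have "compactin mtopology (mtopology closure_of ?S)"
    using comp by (simp only: compact_operator_def)
  from this[unfolded compactin_sequentially, THEN conjunct2, rule_format, OF range]
  obtain F k where k: "strict_mono k" and lim: "limitin mtopology (\<sigma> \<circ> k) F sequentially"
    by blast
  have F: "F \<in> bloch"
    using lim limitin_mspace by blast
  have dist0: "(\<lambda>n. norm_dist bloch bloch_norm (\<sigma> (k n)) F) \<longlonglongrightarrow> 0"
    using lim by (simp add: limitin_metric_dist_null comp_def)
  have wt: "(1 - (norm z)\<^sup>2) * norm (deriv (\<sigma> n) z - deriv F z)
      \<le> norm_dist bloch bloch_norm (\<sigma> n) F" if z: "z \<in> \<D>" for n z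
  proof -
    have "deriv (\<lambda>z. \<sigma> n z - F z) z = deriv (\<sigma> n) z - deriv F z"
      using \<sigma>(1)[of n] F z
      by (intro deriv_diff) (auto simp: bloch_def holo_disc_def holomorphic_on_imp_differentiable_at)
    then have "(1 - (norm z)\<^sup>2) * norm (deriv (\<sigma> n) z - deriv F z) \<le> bloch_seminorm (\<lambda>z. \<sigma> n z - F z)"
      using bloch_weight_le[OF bloch_diff(1)[OF \<sigma>(1) F] z, of n] by simp
    also have "\<dots> \<le> norm_dist bloch bloch_norm (\<sigma> n) F"
      using \<sigma>(1)[of n] F by (simp add: norm_dist_def bloch_norm_def)
    finally show ?thesis .
  qed
  have dF: "deriv F z = 0" if z: "z \<in> \<D>" for z
  proof -
    have pos: "0 < 1 - (norm z)\<^sup>2"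
      using z by (simp add: power_less_one_iff)
    have "(\<lambda>n. real (Suc n) * norm z ^ n / 2 * norm (h z)) \<longlonglongrightarrow> 0"
    proof -
      have "(\<lambda>n. real n * norm z ^ n + norm z ^ n) \<longlonglongrightarrow> 0 + 0"
        using z by (intro tendsto_add powser_times_n_limit_0 LIMSEQ_power_zero) auto
      then have "(\<lambda>n. (real n * norm z ^ n + norm z ^ n) * (norm (h z) / 2)) \<longlonglongrightarrow> 0 * (norm (h z) / 2)"
        by (intro tendsto_mult tendsto_const) simp
      moreover have "(real n * norm z ^ n + norm z ^ n) * (norm (h z) / 2)
          = real (Suc n) * norm z ^ n / 2 * norm (h z)" for n
        by (simp add: algebra_simps)
      ultimately show ?thesis
        by (simp only: mult_zero_left)
    qed
    then have "(\<lambda>n. norm (deriv (\<sigma> n) z)) \<longlonglongrightarrow> 0"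
      by (simp only: nd[OF z])
    then have "(\<lambda>n. deriv (\<sigma> n) z) \<longlonglongrightarrow> 0"
      by (rule tendsto_norm_zero_cancel)
    from LIMSEQ_subseq_LIMSEQ[OF this k] have "(\<lambda>n. deriv (\<sigma> (k n)) z) \<longlonglongrightarrow> 0"
      by (simp add: comp_def)
    then have "(\<lambda>n. (1 - (norm z)\<^sup>2) * norm (deriv (\<sigma> (k n)) z - deriv F z))
        \<longlonglongrightarrow> (1 - (norm z)\<^sup>2) * norm (0 - deriv F z)"
      by (intro tendsto_intros)
    from LIMSEQ_le[OF this dist0] wt[OF z] have "(1 - (norm z)\<^sup>2) * norm (deriv F z) \<le> 0"
      by auto
    with pos show ?thesis
      by (simp add: mult_le_0_iff)
  qed
  have low: "norm (h w) / 8 \<le> norm_dist bloch bloch_norm (\<sigma> n) F"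
    if n: "norm w \<le> 1 - 1 / (2 * real (Suc n))" for n
  proof -
    define r where "r = 1 - 1 / (2 * real (Suc n))"
    have "norm w \<le> r" "r < 1"
      using n by (auto simp: r_def)
    with hol obtain z where z: "norm z = r" "norm (h w) \<le> norm (h z)"
      by (rule maximum_modulus_on_circle)
    have zD: "z \<in> \<D>"
      using z(1) \<open>r < 1\<close> by simp
    have "norm (h w) / 8 = 1 / 4 * (norm (h w) / 2)"
      by simp
    also have "\<dots> \<le> ((1 - r\<^sup>2) * (real (Suc n) * r ^ n)) * (norm (h z) / 2)"
      using z(2) weighted_power_lower_bound[OF r_def] by (intro mult_mono) auto
    also have "\<dots> = (1 - (norm z)\<^sup>2) * norm (deriv (\<sigma> n) z - deriv F z)"
      by (simp add: dF[OF zD] nd[OF zD] z(1))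
    also have "\<dots> \<le> norm_dist bloch bloch_norm (\<sigma> n) F"
      by (rule wt[OF zD])
    finally show ?thesis .
  qed
  have "(\<lambda>n. 1 - 1 / (2 * real (Suc n))) \<longlonglongrightarrow> 1"
    by real_asymp
  then have "eventually (\<lambda>n. norm w < 1 - 1 / (2 * real (Suc n))) sequentially"
    by (rule order_tendstoD(1)) (use w in simp)
  then have "eventually (\<lambda>n. norm w < 1 - 1 / (2 * real (Suc (k n)))) sequentially"
    by (rule eventually_subseq[OF k])
  moreover have "eventually (\<lambda>n. norm_dist bloch bloch_norm (\<sigma> (k n)) F < norm (h w) / 8) sequentially"
    by (rule order_tendstoD(2)[OF dist0]) (use neq in \<open>simp add: h_def\<close>)
  ultimately have "eventually (\<lambda>n. norm w < 1 - 1 / (2 * real (Suc (k n))) \<and>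
      norm_dist bloch bloch_norm (\<sigma> (k n)) F < norm (h w) / 8) sequentially"
    by (rule eventually_conj)
  then obtain N where N: "norm w < 1 - 1 / (2 * real (Suc (k N)))"
    "norm_dist bloch bloch_norm (\<sigma> (k N)) F < norm (h w) / 8"
    by (auto dest!: eventually_happens'[OF sequentially_bot])
  with low[OF less_imp_le[OF N(1)]] show False
    by simp
qed

lemma constant_on_disc_if_rotation_invariant:
  assumes "g holomorphic_on \<D>" "\<And>u z. norm u = 1 \<Longrightarrow> z \<in> \<D> \<Longrightarrow> g (u * z) = g z"
  shows "g constant_on \<D>"
proof -
  have "g w = g 0" if w: "w \<in> \<D>" for w
  proof -
    have "(\<lambda>z. g z - g w) holomorphic_on \<D>"
      using assms(1) by (intro holomorphic_intros)
    then obtain z where z: "norm z = norm w" "norm (g 0 - g w) \<le> norm (g z - g w)"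
      using maximum_modulus_on_circle[of "\<lambda>z. g z - g w" 0 "norm w"] w by auto
    have "g z = g w"
    proof (cases "w = 0")
      case False
      then have "z = z / w * w" "norm (z / w) = 1"
        using z(1) by (auto simp: norm_divide)
      with assms(2) w show ?thesis
        by metis
    qed (use z(1) in simp)
    with z(2) show ?thesis
      by simp
  qed
  then show ?thesis
    unfolding constant_on_def by blast
qed

theorem theorem3p5:
  fixes X :: "(complex \<Rightarrow> complex) set" and NX :: "(complex \<Rightarrow> complex) \<Rightarrow> real"
    and g :: "complex \<Rightarrow> complex"
  assumes "(X, NX) = (H_infty, H_infty_norm) \<or> (X, NX) = (bloch, bloch_norm)"
    and "g \<in> H_infty"
  shows "(\<forall>\<phi>\<in>self_maps. compact_operator X NX bloch bloch_norm (commutator \<phi> g))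
    \<longleftrightarrow> g constant_on \<D>"
proof
  have g: "g holomorphic_on \<D>"
    using assms(2) by (simp add: H_infty_def holo_disc_def)
  assume "\<forall>\<phi>\<in>self_maps. compact_operator X NX bloch bloch_norm (commutator \<phi> g)"
  then have "g (u * z) = g z" if "norm u = 1" "z \<in> \<D>" for u z
    using rotation_invariant_if_compact[OF assms(1) g] rotation_self_map that by blast
  with g show "g constant_on \<D>"
    by (rule constant_on_disc_if_rotation_invariant)
next
  assume "g constant_on \<D>"
  then show "\<forall>\<phi>\<in>self_maps. compact_operator X NX bloch bloch_norm (commutator \<phi> g)"
    using commutator_compact_if_const[OF assms(1)] by (auto simp: constant_on_def)
qed

end
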